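(* For all integers $n \geq 3$ and $s \geq 2$, $\operatorname{dmg}(C_n; s) = n-2$, where $C_n$ is the cycle on $n$ vertices.
   Context: The game with one cop and $s$ robbers on a finite simple graph $G$ is a perfect-information game. In round $0$ the cop chooses an initial vertex, and then each robber chooses an initial vertex (several robbers may share a vertex). Each subsequent round consists of a turn for the cop followed by a turn for the robbers; on their turn, each player may stay put or move to a neighboring vertex (on the robbers' turn every uncaptured robber may do so). Whenever the cop occupies the same vertex as one or more robbers, all those robbers are captured and take no further part in the game. If a robber occupies a vertex $v$ at the end of some round (including round $0$) and that robber is not captured in the following round, then $v$ becomes damaged (and stays damaged). The robbers aim to maximize, and the cop aims to minimize, the total number of damaged vertices. The $s$-robber damage number $\operatorname{dmg}(G;s)$ is the number of vertices damaged under optimal play, i.e. the smallest $d$ such that the cop has a strategy guaranteeing that at most $d$ vertices are ever damaged, whatever the $s$ robbers do. *)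

theory Defs
  imports Main "Graph_Theory.Pair_Digraph"
begin

text \<open>
  A finite simple graph is a \<^locale>\<open>pair_graph\<close> of the AFP entry Graph_Theory: finite,
  loop-free, without parallel arcs, and symmetric, so each edge is a pair of opposite arcs.
\<close>

definition closed_nbhd :: "'a pair_pre_digraph \<Rightarrow> 'a \<Rightarrow> 'a set" where
  "closed_nbhd G v = insert v {w. (v, w) \<in> parcs G}"

text \<open>
  The situation at the end of a round: the position of the cop, and the list of the
  robbers' positions, where \<^term>\<open>None\<close> stands for a captured robber.
\<close>

type_synonym 'a state = "'a \<times> 'a option list"

text \<open>A robber that enters (or chooses in round 0) the vertex \<open>c\<close> of the cop is captured.\<close>

definition arrive :: "'a \<Rightarrow> 'a \<Rightarrow> 'a option" where
  "arrive c w = (if w = c then None else Some w)"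

definition robbers_start :: "'a pair_pre_digraph \<Rightarrow> nat \<Rightarrow> 'a state \<Rightarrow> bool" where
  "robbers_start G s x \<longleftrightarrow>
     (\<exists>ws. length ws = s \<and> set ws \<subseteq> pverts G \<and> snd x = map (arrive (fst x)) ws)"

text \<open>
  The fate of one robber in a round in which the cop has moved to \<open>c\<close>. A robber standing on
  \<open>c\<close> is captured by the cop's move; otherwise it stays put or moves to a neighbour.
\<close>

fun robber_turn :: "'a pair_pre_digraph \<Rightarrow> 'a \<Rightarrow> 'a option \<Rightarrow> 'a option \<Rightarrow> bool" where
  "robber_turn G c None r \<longleftrightarrow> r = None"
| "robber_turn G c (Some v) r \<longleftrightarrow>
     (if v = c then r = None else (\<exists>w \<in> closed_nbhd G v. r = arrive c w))"

text \<open>A play is the infinite sequence of the states at the end of rounds 0, 1, 2, ...\<close>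

definition robbers_legal :: "'a pair_pre_digraph \<Rightarrow> nat \<Rightarrow> (nat \<Rightarrow> 'a state) \<Rightarrow> bool" where
  "robbers_legal G s p \<longleftrightarrow> robbers_start G s (p 0) \<and>
     (\<forall>t. list_all2 (robber_turn G (fst (p (Suc t)))) (snd (p t)) (snd (p (Suc t))))"

definition cop_legal :: "'a pair_pre_digraph \<Rightarrow> (nat \<Rightarrow> 'a state) \<Rightarrow> bool" where
  "cop_legal G p \<longleftrightarrow> fst (p 0) \<in> pverts G \<and>
     (\<forall>t. fst (p (Suc t)) \<in> closed_nbhd G (fst (p t)))"

text \<open>
  The vertices on which some robber ends a round \<open>t\<close> and is still uncaptured at the end of
  round \<open>t + 1\<close>.
\<close>

definition damaged :: "(nat \<Rightarrow> 'a state) \<Rightarrow> 'a set" where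
  "damaged p = {v. \<exists>t. \<exists>k < length (snd (p t)).
     snd (p t) ! k = Some v \<and> snd (p (Suc t)) ! k \<noteq> None}"

text \<open>
  A cop strategy maps the list of all earlier end-of-round states to the cop's next position;
  applied to the empty list it gives the cop's initial vertex.
\<close>

type_synonym 'a cop_strategy = "'a state list \<Rightarrow> 'a"

definition follows :: "'a cop_strategy \<Rightarrow> (nat \<Rightarrow> 'a state) \<Rightarrow> bool" where
  "follows \<sigma> p \<longleftrightarrow> (\<forall>t. fst (p t) = \<sigma> (map p [0..<t]))"

definition cop_guarantees :: "'a pair_pre_digraph \<Rightarrow> nat \<Rightarrow> 'a cop_strategy \<Rightarrow> nat \<Rightarrow> bool" where
  "cop_guarantees G s \<sigma> d \<longleftrightarrow>
     (\<forall>p. robbers_legal G s p \<and> follows \<sigma> p \<longrightarrow> cop_legal G p \<and> card (damaged p) \<le> d)"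

definition dmg :: "'a pair_pre_digraph \<Rightarrow> nat \<Rightarrow> nat" where
  "dmg G s = (LEAST d. \<exists>\<sigma>. cop_guarantees G s \<sigma> d)"

lemma damaged_subset:
  assumes "pair_graph G" "robbers_legal G s p"
  shows "damaged p \<subseteq> pverts G"
proof -
  interpret pair_graph G by fact
  have "\<forall>v. Some v \<in> set (snd (p t)) \<longrightarrow> v \<in> pverts G" for t
  proof (induction t)
    case 0
    then show ?case
      using assms(2) by (auto simp: robbers_legal_def robbers_start_def arrive_def split: if_splits)
  next
    case (Suc t)
    have l: "list_all2 (robber_turn G (fst (p (Suc t)))) (snd (p t)) (snd (p (Suc t)))"
      using assms(2) by (auto simp: robbers_legal_def)
    show ?case
    proof (intro allI impI)
      fix v assume "Some v \<in> set (snd (p (Suc t)))"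
      then obtain r where r: "r \<in> set (snd (p t))" "robber_turn G (fst (p (Suc t))) r (Some v)"
        using l by (auto simp: list_all2_conv_all_nth in_set_conv_nth) metis
      show "v \<in> pverts G"
      proof (cases r)
        case None
        then show ?thesis using r by simp
      next
        case (Some u)
        then show ?thesis
          using r Suc in_arcsD2 by (auto simp: closed_nbhd_def arrive_def split: if_splits)
      qed
    qed
  qed
  then show ?thesis unfolding damaged_def by (smt (verit) mem_Collect_eq nth_mem subsetI)
qed

text \<open>The minimum in the definition of \<^const>\<open>dmg\<close> is attained.\<close>

lemma dmg_attained:
  assumes "pair_graph G" "pverts G \<noteq> {}"
  shows "\<exists>\<sigma>. cop_guarantees G s \<sigma> (dmg G s)"
proof -
  interpret pair_graph G by fact
  obtain v where "v \<in> pverts G" using assms(2) by auto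
  then have "cop_guarantees G s (\<lambda>_. v) (card (pverts G))"
    using damaged_subset[OF assms(1)]
    by (auto simp: cop_guarantees_def follows_def cop_legal_def closed_nbhd_def
        intro!: card_mono pair_finite_verts)
  then have "\<exists>d. \<exists>\<sigma>. cop_guarantees G s \<sigma> d" by blast
  then show ?thesis unfolding dmg_def by (rule LeastI_ex)
qed

text \<open>The cycle with vertices \<open>0, \<dots>, n - 1\<close>; it is a simple graph for \<open>n \<ge> 3\<close>.\<close>

definition cycle_graph :: "nat \<Rightarrow> nat pair_pre_digraph" where
  "cycle_graph n = \<lparr> pverts = {..<n},
     parcs = {(i, j). i < n \<and> j < n \<and> (j = (i + 1) mod n \<or> i = (j + 1) mod n)} \<rparr>"

lemma pair_graph_cycle_graph:
  assumes "n \<ge> 3"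
  shows "pair_graph (cycle_graph n)"
proof -
  have "(i + 1) mod n \<noteq> i" if "i < n" for i
    using that assms by (cases "i + 1 = n") auto
  moreover have "finite (parcs (cycle_graph n))"
    by (rule finite_subset[of _ "{..<n} \<times> {..<n}"]) (auto simp: cycle_graph_def)
  ultimately show ?thesis
    by unfold_locales (auto simp: cycle_graph_def symmetric_def intro!: symI, metis)
qed

end

theory Submission
  imports Defs
begin

text \<open>
  Upper bound: the cop never leaves an edge \<open>uv\<close>. Whenever a robber ends a round on the
  endpoint not occupied by the cop, the cop moves there and captures it, so neither \<open>u\<close> nor \<open>v\<close>
  is ever damaged.

  Lower bound: let one robber play on its own and let all others copy a second one. In the
  universal cover \<open>\<int>\<close> of the cycle, the undamaged vertices form an interval \<open>[a, b]\<close>. With the cop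
  at \<open>C\<close>, the robbers stand at \<open>min (a - 1) (C - 2)\<close> and \<open>max (b + 1) (C + 2)\<close>, so neither can be
  captured in the next round. If the cop moves to a position \<open>\<ge> a + 2\<close>, the first robber can step
  to \<open>a\<close> and will damage it; if the cop moves to a position \<open>\<le> b - 2\<close>, the second one can step
  to \<open>b\<close>. Hence the interval shrinks until it has the form \<open>[a, a + 2]\<close> and the cop stays in its
  middle. Then the robbers step to \<open>a\<close> and \<open>a + 2\<close> simultaneously, and the cop can prevent the
  damage of only one of these vertices.
\<close>

section \<open>Plays against a fixed cop strategy\<close>

text \<open>Once the robbers' reply to the history and to the cop's new position is fixed by
  \<open>\<rho>\<close>, the play is determined: it is built by recursion on the history list
  \<open>h\<close>.\<close>

lemma play_of_responses:
  fixes \<sigma> :: "'a cop_strategy"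
  shows "\<exists>p. follows \<sigma> p \<and> (\<forall>t. snd (p t) = \<rho> (map p [0..<t]) (\<sigma> (map p [0..<t])))"
proof -
  define h where "h = rec_nat [] (\<lambda>_ h. h @ [(\<sigma> h, \<rho> h (\<sigma> h))])"
  define p where "p t = (\<sigma> (h t), \<rho> (h t) (\<sigma> (h t)))" for t
  have "map p [0..<t] = h t" for t
    by (induction t) (simp_all add: h_def p_def)
  then show ?thesis
    by (intro exI[of _ p]) (simp add: follows_def p_def)
qed

text \<open>The default move: always legal, even for a robber captured earlier or just now, so any
  finite beginning of a play extends to an infinite legal one.\<close>

definition stay :: "'a \<Rightarrow> 'a option \<Rightarrow> 'a option" where
  "stay c r = Option.bind r (arrive c)"

lemma robber_turn_stay: "robber_turn G c r (stay c r)"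
  by (cases r) (auto simp: stay_def arrive_def closed_nbhd_def)

lemma list_all2_stay: "list_all2 (robber_turn G c) rs (map (stay c) rs)"
  by (simp add: list_all2_conv_all_nth robber_turn_stay)

lemma play_start:
  assumes "robbers_start G s (\<sigma> [], rs)"
  obtains p where "robbers_legal G s p" "follows \<sigma> p" "p 0 = (\<sigma> [], rs)"
proof -
  obtain p where p: "follows \<sigma> p"
    "\<And>t. snd (p t) = (\<lambda>h c. if h = [] then rs else map (stay c) (snd (last h)))
        (map p [0..<t]) (\<sigma> (map p [0..<t]))"
    using play_of_responses[of \<sigma> "\<lambda>h c. if h = [] then rs else map (stay c) (snd (last h))"]
    by blast
  have p0: "p 0 = (\<sigma> [], rs)"
    using p(1) p(2)[of 0] by (simp add: follows_def prod_eq_iff)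
  have "snd (p (Suc t)) = map (stay (fst (p (Suc t)))) (snd (p t))" for t
    using p(1) p(2)[of "Suc t"] by (simp add: follows_def)
  then have "robbers_legal G s p"
    using assms p0 by (simp add: robbers_legal_def list_all2_stay)
  then show thesis using that p(1) p0 by blast
qed

text \<open>The cop sees only the history, so changing the robbers' moves from round
  \<open>Suc t\<close> on leaves the cop's move in that round unchanged. Hence the robbers may look
  at that move in \<open>p\<close> before choosing \<open>rs\<close>, and a strategy can be
  developed round by round.\<close>

lemma play_redirect:
  assumes "robbers_legal G s p" "follows \<sigma> p"
    and rs: "list_all2 (robber_turn G (fst (p (Suc t)))) (snd (p t)) rs"
  obtains q where "robbers_legal G s q" "follows \<sigma> q" "\<And>i. i \<le> t \<Longrightarrow> q i = p i"
    "q (Suc t) = (fst (p (Suc t)), rs)"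
proof -
  \<comment> \<open>The length of the history is the current round: replay \<open>p\<close> through
    round \<open>t\<close>, play \<open>rs\<close> once, then stay put forever.\<close>
  define \<rho> where "\<rho> h c = (if length h \<le> t then snd (p (length h))
      else if length h = Suc t then rs else map (stay c) (snd (last h)))" for h :: "'a state list" and c
  obtain q where q: "follows \<sigma> q"
    "\<And>i. snd (q i) = \<rho> (map q [0..<i]) (\<sigma> (map q [0..<i]))"
    using play_of_responses[of \<sigma> \<rho>] by blast
  have eq: "q i = p i" if "i \<le> t" for i
    using that
  proof (induction i rule: less_induct)
    case (less i)
    then have "map q [0..<i] = map p [0..<i]" by simp
    then have "fst (q i) = fst (p i)"
      using q(1) assms(2) unfolding follows_def by metis
    moreover have "snd (q i) = snd (p i)"
      using q(2)[of i] less.prems by (simp add: \<rho>_def)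
    ultimately show ?case by (simp add: prod_eq_iff)
  qed
  then have "map q [0..<Suc t] = map p [0..<Suc t]" by simp
  then have "fst (q (Suc t)) = fst (p (Suc t))"
    using q(1) assms(2) unfolding follows_def by metis
  moreover have "snd (q (Suc t)) = rs"
    using q(2)[of "Suc t"] by (simp add: \<rho>_def)
  ultimately have Suc: "q (Suc t) = (fst (p (Suc t)), rs)"
    by (simp add: prod_eq_iff)
  have "list_all2 (robber_turn G (fst (q (Suc i)))) (snd (q i)) (snd (q (Suc i)))" for i
  proof -
    consider "Suc i \<le> t" | "i = t" | "i > t" by linarith
    then show ?thesis
    proof cases
      case 1
      then show ?thesis using assms(1) eq by (simp add: robbers_legal_def)
    next
      case 2
      then show ?thesis using rs eq Suc by simp
    next
      case 3
      then have "snd (q (Suc i)) = map (stay (fst (q (Suc i)))) (snd (q i))"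
        using q(2)[of "Suc i"] q(1) by (simp add: \<rho>_def follows_def)
      then show ?thesis by (simp add: list_all2_stay)
    qed
  qed
  then have "robbers_legal G s q"
    using assms(1) eq by (simp add: robbers_legal_def)
  then show thesis using that q(1) eq Suc by blast
qed

text \<open>Depends only on the states up to round \<open>t\<close>, so this damage survives
  redirecting the play after round \<open>t\<close>.\<close>

definition damaged_before :: "(nat \<Rightarrow> 'a state) \<Rightarrow> nat \<Rightarrow> 'a set" where
  "damaged_before p t = {v. \<exists>i<t. \<exists>k < length (snd (p i)).
     snd (p i) ! k = Some v \<and> snd (p (Suc i)) ! k \<noteq> None}"

lemma damaged_beforeD: "v \<in> damaged_before p t \<Longrightarrow> v \<in> damaged p"
  by (auto simp: damaged_before_def damaged_def)

lemma damaged_before_redirect: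
  assumes "\<And>i. i \<le> t \<Longrightarrow> q i = p i"
  shows "damaged_before p t \<subseteq> damaged_before q (Suc t)"
  unfolding damaged_before_def
proof clarify
  fix v i k y
  assume "i < t" "k < length (snd (p i))" "snd (p i) ! k = Some v" "snd (p (Suc i)) ! k = Some y"
  then show "\<exists>i<Suc t. \<exists>k<length (snd (q i)). snd (q i) ! k = Some v \<and> snd (q (Suc i)) ! k \<noteq> None"
    using assms by (intro exI[of _ i]) auto
qed

lemma damaged_beforeI:
  assumes "k < length (snd (p t))" "snd (p t) ! k = Some v" "snd (p (Suc t)) ! k \<noteq> None"
  shows "v \<in> damaged_before p (Suc t)"
  using assms unfolding damaged_before_def by blast

section \<open>Unwrapping the cycle\<close>

text \<open>The covering map from the integers to the cycle; positions are tracked by lifts, so that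
  left, right and intervals make sense.\<close>

definition vtx :: "nat \<Rightarrow> int \<Rightarrow> nat" where
  "vtx n x = nat (x mod int n)"

lemma vtx_less: "n > 0 \<Longrightarrow> vtx n x < n"
  by (simp add: vtx_def nat_less_iff)

lemma vtx_of_nat: "i < n \<Longrightarrow> vtx n (int i) = i"
  by (simp add: vtx_def)

lemma vtx_add_period: "vtx n (x + int n) = vtx n x"
  by (simp add: vtx_def)

lemma vtx_neq:
  assumes "x \<noteq> y" "\<bar>x - y\<bar> < int n"
  shows "vtx n x \<noteq> vtx n y"
proof
  assume "vtx n x = vtx n y"
  then have "x mod int n = y mod int n"
    using assms by (simp add: vtx_def eq_nat_nat_iff)
  then have "int n dvd x - y" by (simp add: mod_eq_dvd_iff)
  then show False using assms zdvd_imp_le[of "int n" "\<bar>x - y\<bar>"] by auto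
qed

lemma vtx_plus_one:
  assumes "n > 0"
  shows "vtx n (x + 1) = (vtx n x + 1) mod n"
proof -
  have "int (vtx n (x + 1)) = int ((vtx n x + 1) mod n)"
    using assms by (simp add: vtx_def zmod_int mod_simps add.commute)
  then show ?thesis by simp
qed

lemma arcs_cycle_graph_iff:
  assumes "n > 0"
  shows "(vtx n x, w) \<in> parcs (cycle_graph n) \<longleftrightarrow> w = vtx n (x - 1) \<or> w = vtx n (x + 1)"
proof
  assume "(vtx n x, w) \<in> parcs (cycle_graph n)"
  then have w: "w < n" "w = (vtx n x + 1) mod n \<or> vtx n x = (w + 1) mod n"
    by (auto simp: cycle_graph_def)
  have "w = vtx n (x - 1)" if "vtx n x = (w + 1) mod n"
  proof -
    have "vtx n x = vtx n (int w + 1)"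
      using that w(1) assms by (simp add: vtx_plus_one vtx_of_nat)
    then have "x mod int n = (int w + 1) mod int n"
      using assms by (simp add: vtx_def eq_nat_nat_iff)
    then have "(x - 1) mod int n = int w mod int n"
      by (metis add_diff_cancel_right' mod_diff_left_eq)
    then show ?thesis using w(1) by (simp add: vtx_def)
  qed
  then show "w = vtx n (x - 1) \<or> w = vtx n (x + 1)"
    using w assms by (auto simp: vtx_plus_one)
next
  assume "w = vtx n (x - 1) \<or> w = vtx n (x + 1)"
  then show "(vtx n x, w) \<in> parcs (cycle_graph n)"
    using vtx_plus_one[OF assms, of x] vtx_plus_one[OF assms, of "x - 1"] vtx_less[OF assms]
    by (simp add: cycle_graph_def) metis
qed

lemma closed_nbhd_vtx_iff:
  assumes "n > 0"
  shows "w \<in> closed_nbhd (cycle_graph n) (vtx n x) \<longleftrightarrow> (\<exists>y. \<bar>y - x\<bar> \<le> 1 \<and> w = vtx n y)"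
proof -
  have "\<bar>y - x\<bar> \<le> 1 \<longleftrightarrow> y = x \<or> y = x - 1 \<or> y = x + 1" for y by arith
  then show ?thesis
    using assms by (auto simp: closed_nbhd_def arcs_cycle_graph_iff)
qed

section \<open>The robbers' strategy\<close>

locale cycle_cop =
  fixes n s :: nat and \<sigma> :: "nat cop_strategy"
  assumes n_ge_3: "n \<ge> 3" and s_ge_2: "s \<ge> 2"
    and cop_legal: "\<And>p. robbers_legal (cycle_graph n) s p \<Longrightarrow> follows \<sigma> p \<Longrightarrow>
      cop_legal (cycle_graph n) p"
begin

definition robbers_at :: "int \<Rightarrow> int \<Rightarrow> nat option list" where
  "robbers_at x y = Some (vtx n x) # replicate (s - 1) (Some (vtx n y))"

lemma robbers_at_nth:
  "length (robbers_at x y) = s" "robbers_at x y ! 0 = Some (vtx n x)"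
  "robbers_at x y ! Suc 0 = Some (vtx n y)"
  using s_ge_2 by (auto simp: robbers_at_def)

definition config :: "(nat \<Rightarrow> nat state) \<Rightarrow> nat \<Rightarrow> int \<Rightarrow> int \<Rightarrow> int \<Rightarrow> bool" where
  "config p t C x y \<longleftrightarrow> robbers_legal (cycle_graph n) s p \<and> follows \<sigma> p \<and>
     p t = (vtx n C, robbers_at x y)"

lemma config_start:
  obtains C where "\<And>x y. vtx n x \<noteq> vtx n C \<Longrightarrow> vtx n y \<noteq> vtx n C \<Longrightarrow> \<exists>p. config p 0 C x y"
proof -
  have start: "robbers_start (cycle_graph n) s (\<sigma> [], robbers_at x y)"
    if "vtx n x \<noteq> \<sigma> []" "vtx n y \<noteq> \<sigma> []" for x y
    unfolding robbers_start_def
    using that n_ge_3 s_ge_2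
    by (intro exI[of _ "vtx n x # replicate (s - 1) (vtx n y)"])
      (auto simp: robbers_at_def arrive_def cycle_graph_def vtx_less)
  \<comment> \<open>The cop is known to be legal only along legal plays, so some play is needed to
    see that \<open>\<sigma> []\<close> is a vertex.\<close>
  have "robbers_start (cycle_graph n) s (\<sigma> [], replicate s (arrive (\<sigma> []) 0))"
    unfolding robbers_start_def
    using n_ge_3 by (intro exI[of _ "replicate s 0"]) (auto simp: cycle_graph_def)
  then obtain p where "robbers_legal (cycle_graph n) s p" "follows \<sigma> p" "fst (p 0) = \<sigma> []"
    using play_start by (metis fst_conv)
  then have "\<sigma> [] < n"
    using cop_legal[of p] by (simp add: cop_legal_def cycle_graph_def)
  then have C: "vtx n (int (\<sigma> [])) = \<sigma> []" by (simp add: vtx_of_nat)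
  have "\<exists>p. config p 0 (int (\<sigma> [])) x y" if "vtx n x \<noteq> \<sigma> []" "vtx n y \<noteq> \<sigma> []" for x y
    using play_start[where \<sigma> = \<sigma> and rs = "robbers_at x y", OF start[OF that]]
    unfolding config_def C by metis
  then show thesis using that[of "int (\<sigma> [])"] C by simp
qed

lemma config_cop:
  assumes "config p t C x y"
  obtains C' where "\<bar>C' - C\<bar> \<le> 1" "fst (p (Suc t)) = vtx n C'"
proof -
  have "fst (p (Suc t)) \<in> closed_nbhd (cycle_graph n) (fst (p t))" "fst (p t) = vtx n C"
    using cop_legal[of p] assms by (metis config_def cop_legal_def, simp add: config_def)
  then show thesis using that n_ge_3 by (auto simp: closed_nbhd_vtx_iff)
qed

text \<open>The robbers answer the cop's move \<open>C'\<close>. The first two conditions in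
  \<open>safe\<close> say that this move captures nobody, the last two that nobody runs into the
  cop; so all survive the round and their old vertices become damaged.\<close>

lemma config_step:
  assumes "config p t C x y" and C': "fst (p (Suc t)) = vtx n C'"
    and near: "\<bar>x' - x\<bar> \<le> 1" "\<bar>y' - y\<bar> \<le> 1"
    and safe: "vtx n x \<noteq> vtx n C'" "vtx n y \<noteq> vtx n C'" "vtx n x' \<noteq> vtx n C'" "vtx n y' \<noteq> vtx n C'"
  obtains q where "config q (Suc t) C' x' y'"
    "damaged_before p t \<subseteq> damaged_before q (Suc t)"
    "vtx n x \<in> damaged_before q (Suc t)" "vtx n y \<in> damaged_before q (Suc t)"
proof -
  have turn: "robber_turn (cycle_graph n) (vtx n C') (Some (vtx n u)) (Some (vtx n u'))"
    if "\<bar>u' - u\<bar> \<le> 1" "vtx n u \<noteq> vtx n C'" "vtx n u' \<noteq> vtx n C'" for u u'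
    using that n_ge_3
    by (auto simp: arrive_def closed_nbhd_vtx_iff intro!: bexI[of _ "vtx n u'"])
  have "list_all2 (robber_turn (cycle_graph n) (fst (p (Suc t)))) (snd (p t)) (robbers_at x' y')"
    using assms(1) turn[OF near(1) safe(1,3)] turn[OF near(2) safe(2,4)]
    unfolding config_def robbers_at_def C'
    by (simp del: robber_turn.simps add: list_all2_conv_all_nth nth_Cons')
  then obtain q where q: "robbers_legal (cycle_graph n) s q" "follows \<sigma> q"
    "\<And>i. i \<le> t \<Longrightarrow> q i = p i" "q (Suc t) = (vtx n C', robbers_at x' y')"
    using play_redirect[of "cycle_graph n" s p \<sigma> t] assms(1) C' unfolding config_def by metis
  have "snd (q t) = robbers_at x y"
    using q(3)[of t] assms(1) by (simp add: config_def)
  then have "vtx n x \<in> damaged_before q (Suc t)" "vtx n y \<in> damaged_before q (Suc t)"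
    using damaged_beforeI[of 0 q t] damaged_beforeI[of 1 q t] q(4) s_ge_2
    by (simp_all add: robbers_at_nth)
  then show thesis
    using that q damaged_before_redirect[of t q p] by (simp add: config_def)
qed

text \<open>The range contains \<open>n - 2\<close> consecutive integers, on which
  \<open>vtx n\<close> is injective, so this amounts to \<open>n - 2\<close> damaged
  vertices.\<close>

definition robbers_win :: bool where
  "robbers_win \<longleftrightarrow> (\<exists>p a. robbers_legal (cycle_graph n) s p \<and> follows \<sigma> p \<and>
     (\<forall>z. a < z \<and> z \<le> a + (int n - 2) \<longrightarrow> vtx n z \<in> damaged p))"

lemma pincer:
  assumes "config p t (a + 1) a (a + 2)"
    and dam: "\<And>z. a + 2 < z \<Longrightarrow> z < a + int n \<Longrightarrow> vtx n z \<in> damaged_before p t"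
  shows robbers_win
proof -
  obtain C' where C': "fst (p (Suc t)) = vtx n C'"
    using config_cop[OF assms(1)] by metis
  \<comment> \<open>One robber may be captured here, which \<open>config_step\<close> excludes;
    \<open>stay\<close> covers both outcomes.\<close>
  obtain q where q: "robbers_legal (cycle_graph n) s q" "follows \<sigma> q"
    "\<And>i. i \<le> t \<Longrightarrow> q i = p i"
    "q (Suc t) = (vtx n C', map (stay (vtx n C')) (snd (p t)))"
    using play_redirect[of "cycle_graph n" s p \<sigma> t] assms(1) list_all2_stay C'
    unfolding config_def by metis
  have qt: "snd (q t) = robbers_at a (a + 2)"
    and qSt: "snd (q (Suc t)) = map (stay (vtx n C')) (robbers_at a (a + 2))"
    using q(3)[of t] q(4) assms(1) by (simp_all add: config_def)
  have dam': "vtx n z \<in> damaged q" if "a + 2 < z" "z < a + int n" for z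
    using dam[OF that] damaged_before_redirect[of t q p, OF q(3)]
    by (auto intro: damaged_beforeD)
  have "vtx n a \<noteq> vtx n (a + 2)"
    using n_ge_3 by (intro vtx_neq) auto
  then consider "vtx n a \<noteq> vtx n C'" | "vtx n (a + 2) \<noteq> vtx n C'" by metis
  then show ?thesis
  proof cases
    case 1
    then have "vtx n a \<in> damaged_before q (Suc t)"
      using qt qSt s_ge_2
      by (intro damaged_beforeI[of 0]) (auto simp: robbers_at_nth stay_def arrive_def)
    \<comment> \<open>The lift \<open>a + int n\<close> instead of \<open>a\<close> makes the
      damaged integers consecutive.\<close>
    then have "vtx n (a + int n) \<in> damaged q"
      by (simp add: vtx_add_period damaged_beforeD)
    then have "vtx n z \<in> damaged q" if "a + 2 < z" "z \<le> a + 2 + (int n - 2)" for z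
      using that dam'[of z] by (cases "z = a + int n") auto
    then show ?thesis using q(1,2) unfolding robbers_win_def by blast
  next
    case 2
    then have "vtx n (a + 2) \<in> damaged_before q (Suc t)"
      using qt qSt s_ge_2 robbers_at_nth[of a "a + 2"]
      by (intro damaged_beforeI[of 1]) (auto simp: stay_def arrive_def)
    then have "vtx n (a + 2) \<in> damaged q"
      by (rule damaged_beforeD)
    then have "vtx n z \<in> damaged q" if "a + 1 < z" "z \<le> a + 1 + (int n - 2)" for z
      using that dam'[of z] by (cases "z = a + 2") auto
    then show ?thesis using q(1,2) unfolding robbers_win_def by blast
  qed
qed

text \<open>
  The bounds \<open>n - 2\<close> on the distances keep the cop from reaching a robber the other way round the
  cycle. The robbers' current vertices are not yet damaged, but will be after the next round.
\<close>

definition surrounded :: "(nat \<Rightarrow> nat state) \<Rightarrow> nat \<Rightarrow> int \<Rightarrow> int \<Rightarrow> int \<Rightarrow> bool" where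
  "surrounded p t C a b \<longleftrightarrow> config p t C (min (a - 1) (C - 2)) (max (b + 1) (C + 2)) \<and>
     C - (a - 1) \<le> int n - 2 \<and> (b + 1) - C \<le> int n - 2 \<and>
     (\<forall>z. b < z \<and> z < a + int n \<longrightarrow> vtx n z \<in> damaged_before p t \<union>
        {vtx n (min (a - 1) (C - 2)), vtx n (max (b + 1) (C + 2))})"

lemma surrounded_step:
  assumes n: "n \<ge> 4" and sur: "surrounded p t C a b"
    and C': "\<bar>C' - C\<bar> \<le> 1" "fst (p (Suc t)) = vtx n C'"
    and near: "\<bar>x' - min (a - 1) (C - 2)\<bar> \<le> 1" "\<bar>y' - max (b + 1) (C + 2)\<bar> \<le> 1"
    and safe: "x' < C'" "C' < x' + int n" "C' < y'" "y' < C' + int n"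
  obtains q where "config q (Suc t) C' x' y'"
    "\<And>z. b < z \<Longrightarrow> z < a + int n \<Longrightarrow> vtx n z \<in> damaged_before q (Suc t)"
proof -
  let ?x = "min (a - 1) (C - 2)" and ?y = "max (b + 1) (C + 2)"
  have far: "C - (a - 1) \<le> int n - 2" "b + 1 - C \<le> int n - 2"
    using sur by (auto simp: surrounded_def)
  \<comment> \<open>The cop moves by at most 1, so a distance of at most \<open>n - 2\<close>
    becomes at most \<open>n - 1\<close>, and a distance of 2 at most 3; the latter is below
    \<open>n\<close> because \<open>n \<ge> 4\<close>.\<close>
  have "vtx n ?x \<noteq> vtx n C'" "vtx n ?y \<noteq> vtx n C'" "vtx n x' \<noteq> vtx n C'" "vtx n y' \<noteq> vtx n C'"
    using far n C'(1) safe by (intro vtx_neq; linarith)+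
  then obtain q where q: "config q (Suc t) C' x' y'"
    "damaged_before p t \<subseteq> damaged_before q (Suc t)"
    "vtx n ?x \<in> damaged_before q (Suc t)" "vtx n ?y \<in> damaged_before q (Suc t)"
    using config_step[of p t C ?x ?y C' x' y'] sur C'(2) near unfolding surrounded_def by metis
  have "vtx n z \<in> damaged_before q (Suc t)" if "b < z" "z < a + int n" for z
  proof -
    have "vtx n z \<in> damaged_before p t \<union> {vtx n ?x, vtx n ?y}"
      using sur that by (simp add: surrounded_def)
    moreover have "damaged_before p t \<union> {vtx n ?x, vtx n ?y} \<subseteq> damaged_before q (Suc t)"
      using q(2-4) by simp
    ultimately show ?thesis by (rule rev_subsetD)
  qed
  then show thesis using that q(1) by blast
qed

lemma shrink_left:
  assumes n: "n \<ge> 4" and sur: "surrounded p t C a b" and ab: "b - a \<le> int n - 2"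
    and C': "\<bar>C' - C\<bar> \<le> 1" "fst (p (Suc t)) = vtx n C'" and free: "a + 2 \<le> C'"
  obtains q where "surrounded q (Suc t) C' (a + 1) b"
proof -
  have far: "C - (a - 1) \<le> int n - 2" "b + 1 - C \<le> int n - 2"
    using sur by (auto simp: surrounded_def)
  \<comment> \<open>From \<open>free\<close>, \<open>C \<ge> a + 1\<close>, so the first robber is
    at \<open>a - 1\<close> and can step to \<open>a\<close>, while the others keep their distance
    from \<open>C'\<close>.\<close>
  have "\<bar>a - min (a - 1) (C - 2)\<bar> \<le> 1" "\<bar>max (b + 1) (C' + 2) - max (b + 1) (C + 2)\<bar> \<le> 1"
    "a < C'" "C' < a + int n" "C' < max (b + 1) (C' + 2)" "max (b + 1) (C' + 2) < C' + int n"
    using C'(1) free n far ab by linarith+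
  from surrounded_step[OF n sur C' this] obtain q
    where q: "config q (Suc t) C' a (max (b + 1) (C' + 2))"
      and dam: "\<And>z. b < z \<Longrightarrow> z < a + int n \<Longrightarrow> vtx n z \<in> damaged_before q (Suc t)"
    by blast
  \<comment> \<open>The only new integer is \<open>a + int n\<close>, a lift of the vertex where the
    first robber now stands.\<close>
  have "vtx n z \<in> damaged_before q (Suc t) \<union> {vtx n a, vtx n (max (b + 1) (C' + 2))}"
    if "b < z" "z < (a + 1) + int n" for z
    using that dam[of z] vtx_add_period[of n a] by (cases "z = a + int n") auto
  moreover have "min (a + 1 - 1) (C' - 2) = a" using free by simp
  \<comment> \<open>The bound \<open>b + 1 - C' \<le> int n - 2\<close> is restored by
    \<open>free\<close> and \<open>ab\<close>.\<close>
  ultimately have "surrounded q (Suc t) C' (a + 1) b"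
    using q C'(1) free far ab unfolding surrounded_def by auto
  then show thesis using that by blast
qed

lemma shrink_right:
  assumes n: "n \<ge> 4" and sur: "surrounded p t C a b" and ab: "b - a \<le> int n - 2"
    and C': "\<bar>C' - C\<bar> \<le> 1" "fst (p (Suc t)) = vtx n C'" and free: "C' \<le> b - 2"
  obtains q where "surrounded q (Suc t) C' a (b - 1)"
proof -
  have far: "C - (a - 1) \<le> int n - 2" "b + 1 - C \<le> int n - 2"
    using sur by (auto simp: surrounded_def)
  have "\<bar>min (a - 1) (C' - 2) - min (a - 1) (C - 2)\<bar> \<le> 1" "\<bar>b - max (b + 1) (C + 2)\<bar> \<le> 1"
    "min (a - 1) (C' - 2) < C'" "C' < min (a - 1) (C' - 2) + int n" "C' < b" "b < C' + int n"
    using C'(1) free n far ab by linarith+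
  from surrounded_step[OF n sur C' this] obtain q
    where q: "config q (Suc t) C' (min (a - 1) (C' - 2)) b"
      and dam: "\<And>z. b < z \<Longrightarrow> z < a + int n \<Longrightarrow> vtx n z \<in> damaged_before q (Suc t)"
    by blast
  have "vtx n z \<in> damaged_before q (Suc t) \<union> {vtx n (min (a - 1) (C' - 2)), vtx n b}"
    if "b - 1 < z" "z < a + int n" for z
    using that dam[of z] by (cases "z = b") auto
  moreover have "max (b - 1 + 1) (C' + 2) = b" using free by simp
  ultimately have "surrounded q (Suc t) C' a (b - 1)"
    using q C'(1) free far ab unfolding surrounded_def by auto
  then show thesis using that by blast
qed

text \<open>All vertices but those of \<open>a\<close> and \<open>b\<close> are damaged or occupied
  by robbers that cannot be captured next; staying put for one round completes the damage.\<close>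

lemma surrounded_two_win:
  assumes n: "n \<ge> 4" and sur: "surrounded p t C a b" and ab: "b = a + 1"
  shows robbers_win
proof -
  obtain C' where C': "\<bar>C' - C\<bar> \<le> 1" "fst (p (Suc t)) = vtx n C'"
    using sur config_cop unfolding surrounded_def by metis
  have far: "C - (a - 1) \<le> int n - 2" "b + 1 - C \<le> int n - 2"
    using sur by (auto simp: surrounded_def)
  let ?x = "min (a - 1) (C - 2)" and ?y = "max (b + 1) (C + 2)"
  have "\<bar>?x - ?x\<bar> \<le> 1" "\<bar>?y - ?y\<bar> \<le> 1" "?x < C'" "C' < ?x + int n" "C' < ?y" "?y < C' + int n"
    using C'(1) n far by linarith+
  from surrounded_step[OF n sur C' this] obtain q
    where q: "config q (Suc t) C' ?x ?y"
      and dam: "\<And>z. b < z \<Longrightarrow> z < a + int n \<Longrightarrow> vtx n z \<in> damaged_before q (Suc t)"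
    by blast
  have "vtx n z \<in> damaged q" if "b < z" "z \<le> b + (int n - 2)" for z
    using dam[of z] that ab by (auto intro: damaged_beforeD)
  then show ?thesis using q unfolding robbers_win_def config_def by blast
qed

text \<open>
  If the cop comes to the middle \<open>a + 1\<close> from an end of the interval, one robber is still too far
  away for the pincer attack; the robbers then close in and attack one round later.
\<close>

lemma surrounded_three_win:
  assumes n: "n \<ge> 4" and sur: "surrounded p t C a (a + 2)"
  shows robbers_win
proof -
  \<comment> \<open>Off the middle, either \<open>C' \<ge> a + 2\<close> or
    \<open>C' \<le> a\<close>, and one end of the interval can be taken.\<close>
  have shrink: "robbers_win"
    if q: "surrounded q u C a (a + 2)" "\<bar>C' - C\<bar> \<le> 1" "fst (q (Suc u)) = vtx n C'" "C' \<noteq> a + 1"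
    for q u C C'
  proof (cases "a + 2 \<le> C'")
    case True
    then obtain q' where "surrounded q' (Suc u) C' (a + 1) (a + 2)"
      using shrink_left[OF n q(1) _ q(2,3)] n by auto
    then show ?thesis by (rule surrounded_two_win[OF n]) simp
  next
    case False
    then obtain q' where "surrounded q' (Suc u) C' a (a + 2 - 1)"
      using shrink_right[OF n q(1) _ q(2,3)] q(4) n by auto
    then show ?thesis by (rule surrounded_two_win[OF n]) simp
  qed
  obtain C' where C': "\<bar>C' - C\<bar> \<le> 1" "fst (p (Suc t)) = vtx n C'"
    using sur config_cop unfolding surrounded_def by metis
  show ?thesis
  proof (cases "C' = a + 1")
    case False
    then show ?thesis using shrink sur C' by blast
  next
    case True
    have "\<bar>(a - 1) - min (a - 1) (C - 2)\<bar> \<le> 1" "\<bar>(a + 3) - max (a + 2 + 1) (C + 2)\<bar> \<le> 1"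
      "a - 1 < C'" "C' < a - 1 + int n" "C' < a + 3" "a + 3 < C' + int n"
      using C'(1) True n by linarith+
    from surrounded_step[OF n sur C' this] obtain q
      where q: "config q (Suc t) (a + 1) (a - 1) (a + 3)"
        and dam: "\<And>z. a + 2 < z \<Longrightarrow> z < a + int n \<Longrightarrow> vtx n z \<in> damaged_before q (Suc t)"
      unfolding True by blast
    have sur': "surrounded q (Suc t) (a + 1) a (a + 2)"
      using q dam n unfolding surrounded_def by (auto simp: add.commute)
    obtain C'' where C'': "\<bar>C'' - (a + 1)\<bar> \<le> 1" "fst (q (Suc (Suc t))) = vtx n C''"
      using q config_cop by metis
    show ?thesis
    proof (cases "C'' = a + 1")
      case False
      then show ?thesis using shrink sur' C'' by blast
    next
      case True
      have "\<bar>a - min (a - 1) (a + 1 - 2)\<bar> \<le> 1" "\<bar>(a + 2) - max (a + 2 + 1) (a + 1 + 2)\<bar> \<le> 1"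
        "a < C''" "C'' < a + int n" "C'' < a + 2" "a + 2 < C'' + int n"
        using True n by linarith+
      from surrounded_step[OF n sur' C'' this] obtain q'
        where "config q' (Suc (Suc t)) (a + 1) a (a + 2)"
          "\<And>z. a + 2 < z \<Longrightarrow> z < a + int n \<Longrightarrow> vtx n z \<in> damaged_before q' (Suc (Suc t))"
        unfolding True by blast
      then show ?thesis by (rule pincer)
    qed
  qed
qed

text \<open>If \<open>b - a \<ge> 3\<close>, every integer is at least \<open>a + 2\<close> or at
  most \<open>b - 2\<close>, so no move of the cop prevents the interval from shrinking, until
  \<open>b - a = 2\<close>.\<close>

lemma surrounded_win:
  assumes n: "n \<ge> 4" and "surrounded p t C a b" "b = a + int m + 2" "b - a \<le> int n - 2"
  shows robbers_win
  using assms(2-)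
proof (induction m arbitrary: p t C a b)
  case 0
  then show ?case using surrounded_three_win[OF n] by simp
next
  case (Suc m)
  obtain C' where C': "\<bar>C' - C\<bar> \<le> 1" "fst (p (Suc t)) = vtx n C'"
    using Suc.prems(1) config_cop unfolding surrounded_def by metis
  show ?case
  proof (cases "a + 2 \<le> C'")
    case True
    then obtain q where "surrounded q (Suc t) C' (a + 1) b"
      using shrink_left[OF n Suc.prems(1,3) C'] by blast
    then show ?thesis by (rule Suc.IH) (use Suc.prems(2,3) in auto)
  next
    case False
    then have "C' \<le> b - 2" using Suc.prems(2) by simp
    then obtain q where "surrounded q (Suc t) C' a (b - 1)"
      using shrink_right[OF n Suc.prems(1,3) C'] by blast
    then show ?thesis by (rule Suc.IH) (use Suc.prems(2,3) in auto)
  qed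
qed

lemma robbers_win: robbers_win
proof -
  obtain C where C: "\<And>x y. vtx n x \<noteq> vtx n C \<Longrightarrow> vtx n y \<noteq> vtx n C \<Longrightarrow> \<exists>p. config p 0 C x y"
    using config_start by blast
  show ?thesis
  proof (cases "n = 3")
    case True
    \<comment> \<open>A triangle has no two vertices at distance 2, but the robbers can start in the
      pincer position at once.\<close>
    obtain p where "config p 0 C (C - 1) (C + 1)"
      using C[of "C - 1" "C + 1"] vtx_neq[of _ C n] n_ge_3 by auto
    then show ?thesis
      using pincer[of p 0 "C - 1"] True by (simp add: add.commute)
  next
    case False
    then have n: "n \<ge> 4" using n_ge_3 by simp
    \<comment> \<open>Both lifts are the same vertex, so all robbers start together at distance 2
      from the cop; the undamaged interval consists of the other \<open>n - 1\<close>
      vertices.\<close>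
    obtain p where p: "config p 0 C (C - 2) (C + int n - 2)"
      using C[of "C - 2" "C + int n - 2"] vtx_neq[of _ C n] n by auto
    have "min (C - 1 - 1) (C - 2) = C - 2" "max (C + int n - 3 + 1) (C + 2) = C + int n - 2"
      using n by linarith+
    moreover have "z = C + int n - 2" if "C + int n - 3 < z" "z < C - 1 + int n" for z
      using that by linarith
    ultimately have "surrounded p 0 C (C - 1) (C + int n - 3)"
      using p n unfolding surrounded_def by fastforce
    then show ?thesis
      by (rule surrounded_win[where m = "n - 4", OF n]) (use n in auto)
  qed
qed

end

section \<open>Counting the damaged vertices\<close>

lemma cycle_damage_ge:
  assumes "n \<ge> 3" "s \<ge> 2" "cop_guarantees (cycle_graph n) s \<sigma> d"
  shows "n - 2 \<le> d"
proof -
  interpret cycle_cop n s \<sigma>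
    using assms by unfold_locales (auto simp: cop_guarantees_def)
  obtain p a where p: "robbers_legal (cycle_graph n) s p" "follows \<sigma> p"
    and dam: "\<And>z. a < z \<Longrightarrow> z \<le> a + (int n - 2) \<Longrightarrow> vtx n z \<in> damaged p"
    using robbers_win unfolding robbers_win_def by blast
  have "inj_on (vtx n) {a<..a + (int n - 2)}"
  proof (rule inj_onI, rule ccontr)
    fix y z assume *: "y \<in> {a<..a + (int n - 2)}" "z \<in> {a<..a + (int n - 2)}" "vtx n y = vtx n z"
      and "y \<noteq> z"
    then have "\<bar>y - z\<bar> < int n" by auto
    then show False using vtx_neq * \<open>y \<noteq> z\<close> by blast
  qed
  then have "n - 2 = card (vtx n ` {a<..a + (int n - 2)})"
    using assms(1) by (simp add: card_image nat_diff_distrib)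
  also have "\<dots> \<le> card (damaged p)"
  proof (rule card_mono)
    have "damaged p \<subseteq> {..<n}"
      using damaged_subset[OF pair_graph_cycle_graph[OF assms(1)] p(1)] by (simp add: cycle_graph_def)
    then show "finite (damaged p)" by (rule finite_subset) simp
  qed (use dam in auto)
  also have "\<dots> \<le> d" using assms(3) p by (auto simp: cop_guarantees_def)
  finally show ?thesis .
qed

section \<open>The cop's strategy\<close>

lemma edge_guarding_guarantees:
  assumes "pair_graph G" "(u, v) \<in> parcs G"
  shows "\<exists>\<sigma>. cop_guarantees G s \<sigma> (card (pverts G) - 2)"
proof -
  interpret pair_graph G by fact
  have uv: "u \<in> pverts G" "v \<in> pverts G" "u \<noteq> v" "(v, u) \<in> parcs G"
    using in_arcsD1[OF assms(2)] in_arcsD2[OF assms(2)] no_loops[OF assms(2)]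
      arcs_symmetric[OF assms(2)]
    by simp_all
  define other where "other c = (if c = u then v else u)" for c
  define \<sigma> where "\<sigma> h = (if h = [] then u else let (c, rs) = last h in
      if Some (other c) \<in> set rs then other c else c)" for h :: "'a state list"
  have "cop_legal G p \<and> card (damaged p) \<le> card (pverts G) - 2"
    if leg: "robbers_legal G s p" and fol: "follows \<sigma> p" for p
  proof -
    have step: "fst (p (Suc t)) =
        (if Some (other (fst (p t))) \<in> set (snd (p t)) then other (fst (p t)) else fst (p t))" for t
      using fol by (auto simp: follows_def \<sigma>_def Let_def split_beta)
    have start: "fst (p 0) = u"
      using fol by (simp add: follows_def \<sigma>_def)
    have on: "fst (p t) \<in> {u, v}" for t
      by (induction t) (auto simp: step start other_def)
    have "other (fst (p t)) \<in> closed_nbhd G (fst (p t))" for t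
      using on[of t] assms(2) uv by (auto simp: other_def closed_nbhd_def)
    then have "cop_legal G p"
      using uv start by (simp add: cop_legal_def step) (simp add: closed_nbhd_def)
    moreover have "damaged p \<subseteq> pverts G - {u, v}"
    proof -
      have turn: "list_all2 (robber_turn G (fst (p (Suc t)))) (snd (p t)) (snd (p (Suc t)))" for t
        using leg by (simp add: robbers_legal_def)
      \<comment> \<open>No robber ends a round on the cop's vertex, so one that ends it on
        \<open>u\<close> or \<open>v\<close> is at the endpoint opposite the cop, which the cop
        enters next.\<close>
      have not_cop: "Some (fst (p t)) \<notin> set (snd (p t))" for t
      proof (cases t)
        case 0
        then show ?thesis
          using leg by (auto simp: robbers_legal_def robbers_start_def arrive_def split: if_splits)
      next
        case (Suc i)
        have "\<not> robber_turn G c r (Some c)" for c r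
          by (cases r) (auto simp: arrive_def)
        then show ?thesis
          using turn[of i] Suc by (auto simp: list_all2_conv_all_nth in_set_conv_nth)
      qed
      have "w \<notin> {u, v}"
        if k: "k < length (snd (p t))" "snd (p t) ! k = Some w" "snd (p (Suc t)) ! k \<noteq> None" for t k w
      proof
        assume "w \<in> {u, v}"
        have w: "Some w \<in> set (snd (p t))" using k by (metis nth_mem)
        then have "w = other (fst (p t))"
          using not_cop[of t] on[of t] \<open>w \<in> {u, v}\<close> by (auto simp: other_def)
        then have "fst (p (Suc t)) = w" using step w by simp
        then show False
          using turn[of t] k by (auto simp: list_all2_conv_all_nth)
      qed
      then have "damaged p \<inter> {u, v} = {}" unfolding damaged_def by blast
      then show ?thesis using damaged_subset[OF assms(1) leg] by blast
    qed
    then have "card (damaged p) \<le> card (pverts G - {u, v})"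
      by (intro card_mono) auto
    moreover have "card (pverts G - {u, v}) = card (pverts G) - 2"
      using uv by (subst card_Diff_subset) auto
    ultimately show ?thesis by simp
  qed
  then show ?thesis unfolding cop_guarantees_def by blast
qed

theorem theorem3p4:
  fixes n s :: nat
  assumes "n \<ge> 3" and "s \<ge> 2"
  shows "dmg (cycle_graph n) s = n - 2"
  unfolding dmg_def
proof (rule Least_equality)
  have "(0, 1) \<in> parcs (cycle_graph n)" using assms(1) by (simp add: cycle_graph_def)
  from edge_guarding_guarantees[OF pair_graph_cycle_graph[OF assms(1)] this]
  show "\<exists>\<sigma>. cop_guarantees (cycle_graph n) s \<sigma> (n - 2)" by (simp add: cycle_graph_def)
next
  show "n - 2 \<le> d" if "\<exists>\<sigma>. cop_guarantees (cycle_graph n) s \<sigma> d" for d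
    using that cycle_damage_ge assms by blast
qed

end
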